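(* For every integer $n \ge 12$, with $P_{n,H}(k) := P(|S-S| = k)$ where $S$ is a uniformly random subset of $[n]=\{0,1,\dots,n-1\}$, we have \[ P_{n,H}(3) > P_{n,H}(5) < P_{n,H}(7),\qquad P_{n,H}(7) > P_{n,H}(9) < P_{n,H}(11),\qquad P_{n,H}(13) > P_{n,H}(15) < P_{n,H}(17). \]
   Context: For a positive integer $n$, $[n] := \{0,1,\dots,n-1\}$, and $S$ is chosen uniformly at random among all $2^n$ subsets of $[n]$ (equivalently, each element is included independently with probability $1/2$). The difference set is $S-S := \{x-y : x,y \in S\}$, and $|A|$ denotes the cardinality of a set $A$. *)

theory Defs
  imports "HOL-Probability.Probability"
begin

definition diff_set :: "int set \<Rightarrow> int set"
  where "diff_set S = {x - y | x y. x \<in> S \<and> y \<in> S}"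

definition P_H :: "nat \<Rightarrow> nat \<Rightarrow> real"
  where "P_H n k =
    measure_pmf.prob (pmf_of_set (Pow {0..<int n})) {S. card (diff_set S) = k}"

end

theory Submission
  imports Defs
begin

text \<open>
  Read from left to right, a set of integers is given by its minimum and the composition of its
  diameter \<open>m\<close> into gaps; its positive differences are the sums of blocks of consecutive gaps.
  Let \<open>E k m\<close> be the number of compositions of \<open>m\<close> with \<open>k\<close> distinct block sums. A set with \<open>k\<close>
  positive differences has \<open>2 * k + 1\<close> differences, so \<open>2 ^ n * P_H n (2 * k + 1)\<close> is the sum of
  \<open>(n - m) * E k m\<close> over \<open>0 < m < n\<close>, and it suffices to compare \<open>E k m\<close> termwise for \<open>m \<ge> 12\<close>
  and to know its values for \<open>m < 12\<close>.

  For \<open>m \<ge> 28\<close> the comparison is one of growth rates. A coincidence between two block sums is a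
  linear equation between the gaps, so few block sums confine the gaps to low-dimensional cones.
  Generic compositions of length 2 and 3 have 3 and 6 block sums, and compositions \<open>[u, v, w, u]\<close>,
  \<open>[u, v, w, u + v]\<close> and \<open>[u + v, w, v, u]\<close> generically have 8; so \<open>E 3\<close> grows linearly, and \<open>E 6\<close>
  and \<open>E 8\<close> grow quadratically. But 4 or 7 block sums force so many coincidences that, up to
  finitely many rays, only two-parameter families remain, and \<open>E 4\<close> and \<open>E 7\<close> grow linearly; \<open>E 4\<close>
  comes from the palindromes \<open>[u, v, u]\<close> and is beaten by the families \<open>[u, u, v]\<close> and \<open>[v, u, u]\<close>
  in \<open>E 5\<close>. For \<open>m < 28\<close> the numbers are computed by a pruned search.
\<close>

section \<open>Compositions and block sums\<close>

definition compositions :: "nat \<Rightarrow> nat list set"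
  where "compositions m = {gs. sum_list gs = m \<and> 0 \<notin> set gs}"

fun prefix_sums :: "nat list \<Rightarrow> nat set" where
  "prefix_sums [] = {}"
| "prefix_sums (g # gs) = insert g ((+) g ` prefix_sums gs)"

fun block_sums :: "nat list \<Rightarrow> nat set" where
  "block_sums [] = {}"
| "block_sums (g # gs) = prefix_sums (g # gs) \<union> block_sums gs"

definition block_class :: "nat \<Rightarrow> nat \<Rightarrow> nat list set"
  where "block_class k m = {gs \<in> compositions m. card (block_sums gs) = k}"

lemma finite_prefix_sums [simp]: "finite (prefix_sums gs)"
  by (induction gs) auto

lemma finite_block_sums [simp]: "finite (block_sums gs)"
  by (induction gs) auto

lemma prefix_sums_subset_block_sums: "prefix_sums gs \<subseteq> block_sums gs"
  by (cases gs) auto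

lemma zero_notin_prefix_sums: "0 \<notin> set gs \<Longrightarrow> 0 \<notin> prefix_sums gs"
  by (induction gs) auto

lemma zero_notin_block_sums: "0 \<notin> set gs \<Longrightarrow> 0 \<notin> block_sums gs"
  using zero_notin_prefix_sums by (induction gs) fastforce+

lemma block_sums_le_sum_list: "s \<in> block_sums gs \<Longrightarrow> s \<le> sum_list gs"
proof (induction gs arbitrary: s)
  case (Cons g gs)
  then show ?case using prefix_sums_subset_block_sums[of gs] by fastforce
qed simp

lemma sum_list_in_prefix_sums: "gs \<noteq> [] \<Longrightarrow> sum_list gs \<in> prefix_sums gs"
proof (induction gs)
  case (Cons g gs)
  then show ?case by (cases gs) auto
qed simp

lemma card_prefix_sums: "0 \<notin> set gs \<Longrightarrow> card (prefix_sums gs) = length gs"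
proof (induction gs)
  case (Cons g gs)
  then have "g \<notin> (+) g ` prefix_sums gs" using zero_notin_prefix_sums by auto
  then show ?case using Cons by (simp add: card_image)
qed simp

lemma length_le_card_block_sums: "0 \<notin> set gs \<Longrightarrow> length gs \<le> card (block_sums gs)"
  by (metis card_mono card_prefix_sums finite_block_sums prefix_sums_subset_block_sums)

lemma card_block_sums_le:
  "0 \<notin> set gs \<Longrightarrow> 2 * card (block_sums gs) \<le> length gs * (length gs + 1)"
proof (induction gs)
  case (Cons g gs)
  have "card (block_sums (g # gs)) \<le> card (prefix_sums (g # gs)) + card (block_sums gs)"
    by (simp only: block_sums.simps card_Un_le)
  then show ?case using Cons card_prefix_sums[OF Cons.prems] by simp
qed simp

lemma block_sums_minus_prefix_sums:
  assumes "0 \<notin> set gs"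
  obtains zs where "set zs = block_sums gs - prefix_sums gs" "distinct zs"
    "length zs = card (block_sums gs) - length gs"
proof -
  obtain zs where zs: "set zs = block_sums gs - prefix_sums gs" "distinct zs"
    by (metis finite_Diff finite_block_sums finite_distinct_list)
  moreover have "length zs = card (block_sums gs) - length gs"
    using zs distinct_card[OF zs(2)] assms prefix_sums_subset_block_sums[of gs]
    by (simp add: card_Diff_subset card_prefix_sums)
  ultimately show thesis using that by blast
qed

lemma finite_compositions [simp]: "finite (compositions m)"
proof (rule finite_subset)
  have "length gs \<le> sum_list gs" if "0 \<notin> set gs" for gs :: "nat list"
    using that by (induction gs) auto
  then show "compositions m \<subseteq> {gs. set gs \<subseteq> {..m} \<and> length gs \<le> m}"
    using member_le_sum_list by (fastforce simp: compositions_def)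
qed (simp add: finite_lists_length_le)

lemma finite_block_class [simp]: "finite (block_class k m)"
  by (simp add: block_class_def)

lemma card_compositions_length:
  assumes "k \<le> m" "0 < k"
  shows "card {gs \<in> compositions m. length gs = k} = (m - 1) choose (k - 1)"
proof -
  have sum_Suc: "sum_list (map Suc hs) = sum_list hs + length hs" for hs
    by (induction hs) auto
  have "{gs \<in> compositions m. length gs = k} = map Suc ` {hs. length hs = k \<and> sum_list hs = m - k}"
  proof (intro equalityI subsetI)
    fix gs assume gs: "gs \<in> {gs \<in> compositions m. length gs = k}"
    define hs where "hs = map (\<lambda>g. g - 1) gs"
    have "gs = map Suc hs"
      using gs
      by (auto simp: hs_def compositions_def o_def intro!: map_idI[symmetric] Suc_pred gr0I)
    then have "length hs = k" "sum_list hs = m - k"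
      using gs sum_Suc[of hs] by (auto simp: hs_def compositions_def)
    then show "gs \<in> map Suc ` {hs. length hs = k \<and> sum_list hs = m - k}"
      using \<open>gs = map Suc hs\<close> by blast
  qed (use assms in \<open>auto simp: compositions_def sum_Suc\<close>)
  moreover have "inj_on (map Suc) A" for A by (simp add: inj_on_def)
  ultimately have "card {gs \<in> compositions m. length gs = k} = (m - k + k - 1) choose (m - k)"
    by (simp add: card_image card_length_sum_list)
  also have "\<dots> = (m - 1) choose (k - 1)"
    using assms binomial_symmetric[of "k - 1" "m - 1"] by simp
  finally show ?thesis .
qed

section \<open>Random sets as translated compositions\<close>

fun marks :: "int \<Rightarrow> nat list \<Rightarrow> int set" where
  "marks i [] = {i}"
| "marks i (g # gs) = insert i (marks (i + int g) gs)"

lemma marks_eq: "marks i gs = (\<lambda>s. i + int s) ` insert 0 (prefix_sums gs)"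
  by (induction gs arbitrary: i) (auto simp: image_image add.assoc)

lemma marks_bounds: "x \<in> marks i gs \<Longrightarrow> i \<le> x \<and> x \<le> i + int (sum_list gs)"
  by (induction gs arbitrary: i) force+

lemma first_mark: "i \<in> marks i gs"
  by (cases gs) auto

lemma last_mark: "i + int (sum_list gs) \<in> marks i gs"
  by (induction gs arbitrary: i) (auto simp flip: add.assoc)

lemma marks_inject:
  assumes "marks i gs = marks j hs" "0 \<notin> set gs" "0 \<notin> set hs"
  shows "i = j \<and> gs = hs"
  using assms
proof (induction gs arbitrary: i j hs)
  case Nil
  have "j \<in> {i}" "j + int (sum_list hs) \<in> {i}"
    using first_mark[of j hs] last_mark[of j hs] Nil(1) by auto
  then show ?case using Nil(3) by (cases hs) auto
next
  case (Cons g gs)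
  have "i \<in> marks j hs" "j \<in> marks i (g # gs)"
    using Cons.prems(1) first_mark by metis+
  then have ij: "i = j" using marks_bounds[of i j hs] marks_bounds[of j i "g # gs"] by simp
  have "i + int g \<in> marks j hs" using Cons.prems(1) first_mark by auto
  then obtain h hs' where hs: "hs = h # hs'" using Cons.prems(2) ij by (cases hs) auto
  have pos: "0 < g" "0 < h" using Cons.prems(2,3) hs by auto
  have "marks (i + int g) gs = marks i (g # gs) - {i}"
    using marks_bounds[of i "i + int g" gs] pos by auto
  also have "\<dots> = marks (i + int h) hs'"
    using marks_bounds[of i "i + int h" hs'] pos Cons.prems(1) hs ij by auto
  finally show ?case using Cons.IH[of "i + int g" "i + int h" hs'] Cons.prems(2,3) hs ij by simp
qed

lemma marks_exhaust:
  fixes S :: "int set"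
  assumes "finite S" "S \<noteq> {}"
  obtains i gs where "0 \<notin> set gs" "S = marks i gs"
proof -
  have "S \<noteq> {} \<Longrightarrow> \<exists>i gs. 0 \<notin> set gs \<and> S = marks i gs"
    using assms(1)
  proof (induction rule: finite_linorder_min_induct)
    case (insert b A)
    show ?case
    proof (cases "A = {}")
      case True
      then show ?thesis by (intro exI[of _ b] exI[of _ "[]"]) simp
    next
      case False
      then obtain i gs where gs: "0 \<notin> set gs" "A = marks i gs" using insert.IH by blast
      then have "b < i" using insert.hyps first_mark by blast
      then have "insert b A = marks b (nat (i - b) # gs)" "0 \<notin> set (nat (i - b) # gs)"
        using gs by simp_all
      then show ?thesis by blast
    qed
  qed simp
  then show thesis using assms(2) that by blast
qed

lemma diff_set_marks:
  "diff_set (marks i gs) = insert 0 (int ` block_sums gs \<union> (\<lambda>s. - int s) ` block_sums gs)"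
proof (induction gs arbitrary: i)
  case Nil
  then show ?case by (auto simp: diff_set_def)
next
  case (Cons g gs)
  let ?T = "marks (i + int g) gs"
  have "diff_set (insert i ?T) = insert 0 (diff_set ?T \<union> (\<lambda>t. t - i) ` ?T \<union> (\<lambda>t. i - t) ` ?T)"
    unfolding diff_set_def by auto
  moreover have "(\<lambda>t. t - i) ` ?T = int ` prefix_sums (g # gs)"
    "(\<lambda>t. i - t) ` ?T = (\<lambda>s. - int s) ` prefix_sums (g # gs)"
    unfolding marks_eq by (simp_all add: image_image)
  ultimately show ?case using Cons.IH by (simp add: image_Un Un_ac del: prefix_sums.simps)
qed

lemma card_diff_set_marks:
  assumes "0 \<notin> set gs"
  shows "card (diff_set (marks i gs)) = 2 * card (block_sums gs) + 1"
proof -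
  have pos: "0 < s" if "s \<in> block_sums gs" for s
    using zero_notin_block_sums[OF assms] that by (cases s) auto
  then have "int ` block_sums gs \<inter> (\<lambda>s. - int s) ` block_sums gs = {}" by fastforce
  moreover have "0 \<notin> int ` block_sums gs \<union> (\<lambda>s. - int s) ` block_sums gs" using pos by fastforce
  ultimately show ?thesis
    unfolding diff_set_marks by (simp add: card_Un_disjoint card_image inj_on_def)
qed

lemma bij_betw_marks:
  assumes "0 < k"
  shows "bij_betw (\<lambda>(m, i, gs). marks (int i) gs)
    (SIGMA m : {1..<n}. {..<n - m} \<times> block_class k m)
    {S \<in> Pow {0..<int n}. card (diff_set S) = 2 * k + 1}"
    (is "bij_betw ?f ?I ?F")
proof (rule bij_betwI')
  fix x y assume xy: "x \<in> ?I" "y \<in> ?I"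
  obtain m i gs m' i' gs' where eq: "x = (m, i, gs)" "y = (m', i', gs')"
    by (cases x, cases y) auto
  have "0 \<notin> set gs" "0 \<notin> set gs'" "m = sum_list gs" "m' = sum_list gs'"
    using xy eq by (auto simp: block_class_def compositions_def)
  then show "?f x = ?f y \<longleftrightarrow> x = y" using marks_inject[of "int i" gs "int i'" gs'] eq by auto
next
  fix x assume "x \<in> ?I"
  then obtain m i gs where "x = (m, i, gs)" "i + sum_list gs < n" "0 \<notin> set gs"
    "card (block_sums gs) = k"
    by (fastforce simp: block_class_def compositions_def)
  then show "?f x \<in> ?F" using marks_bounds[of _ "int i" gs] by (fastforce simp: card_diff_set_marks)
next
  fix S assume S: "S \<in> ?F"
  then have "finite S" "S \<noteq> {}" by (auto intro: finite_subset simp: diff_set_def)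
  then obtain i gs where gs: "0 \<notin> set gs" "S = marks i gs" by (rule marks_exhaust)
  then have k: "card (block_sums gs) = k" using S by (simp add: card_diff_set_marks)
  then have "gs \<noteq> []" using assms by auto
  then have "0 < sum_list gs" using gs(1) by (cases gs) auto
  moreover have "0 \<le> i" "i + int (sum_list gs) < int n"
    using S gs(2) first_mark last_mark by fastforce+
  ultimately have "(sum_list gs, nat i, gs) \<in> ?I" "S = ?f (sum_list gs, nat i, gs)"
    using gs k by (auto simp: block_class_def compositions_def)
  then show "\<exists>x \<in> ?I. S = ?f x" by blast
qed

lemma card_subsets_eq_sum_block_class:
  assumes "0 < k"
  shows "card {S \<in> Pow {0..<int n}. card (diff_set S) = 2 * k + 1} =
    (\<Sum>m = 1..<n. (n - m) * card (block_class k m))"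
  using bij_betw_same_card[OF bij_betw_marks[OF assms, of n]]
  by (simp add: card_SigmaI card_cartesian_product)

lemma P_H_eq:
  assumes "0 < k"
  shows "P_H n (2 * k + 1) = real (\<Sum>m = 1..<n. (n - m) * card (block_class k m)) / 2 ^ n"
proof -
  have "Pow {0..<int n} \<inter> {S. card (diff_set S) = 2 * k + 1} =
      {S \<in> Pow {0..<int n}. card (diff_set S) = 2 * k + 1}"
    by blast
  then show ?thesis
    unfolding P_H_def using card_subsets_eq_sum_block_class[OF assms, of n]
    by (subst measure_pmf_of_set) (auto simp: card_Pow simp del: of_nat_sum)
qed

section \<open>Lines and rays of compositions\<close>

definition line :: "(nat \<Rightarrow> nat \<Rightarrow> nat list) \<Rightarrow> nat list set"
  where "line f = {f u v | u v. 0 < u \<and> 0 < v}"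

definition ray :: "nat list \<Rightarrow> nat list set"
  where "ray r = range (\<lambda>t. map ((*) t) r)"

definition linear_sum :: "(nat \<Rightarrow> nat \<Rightarrow> nat list) \<Rightarrow> bool"
  where "linear_sum f \<longleftrightarrow> 0 < sum_list (f 1 0) \<and> 0 < sum_list (f 0 1) \<and>
    (\<forall>u v. sum_list (f u v) = sum_list (f 1 0) * u + sum_list (f 0 1) * v)"

definition period :: "(nat \<Rightarrow> nat \<Rightarrow> nat list) \<Rightarrow> nat"
  where "period f = lcm (sum_list (f 1 0)) (sum_list (f 0 1))"

lemma card_line_le:
  assumes "linear_sum f"
  shows "card (compositions m \<inter> line f) \<le> m div period f + 1"
proof -
  define x y where "x = sum_list (f 1 0)" and "y = sum_list (f 0 1)"
  have pos: "0 < x" "0 < y" and sum: "sum_list (f u v) = x * u + y * v" for u v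
    using assms unfolding linear_sum_def x_def y_def by blast+
  define U where "U = {u. x * u \<le> m \<and> y dvd m - x * u}"
  have "compositions m \<inter> line f \<subseteq> (\<lambda>u. f u ((m - x * u) div y)) ` U"
  proof
    fix gs assume "gs \<in> compositions m \<inter> line f"
    then obtain u v where "gs = f u v" "x * u + y * v = m"
      using sum by (auto simp: line_def compositions_def)
    then show "gs \<in> (\<lambda>u. f u ((m - x * u) div y)) ` U"
      using pos by (intro image_eqI[of _ _ u]) (auto simp: U_def)
  qed
  moreover have U_div: "(\<lambda>u. x * u div lcm x y) ` U \<subseteq> {..m div lcm x y}"
    by (auto simp: U_def div_le_mono)
  moreover have inj: "inj_on (\<lambda>u. x * u div lcm x y) U"
  proof (rule linorder_inj_onI)
    fix u w assume uw: "u < w" "u \<in> U" "w \<in> U"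
    then obtain d where d: "w = u + d" "0 < d" using less_imp_add_positive by blast
    have "y dvd (m - x * u) - (m - x * w)" using uw unfolding U_def by (blast intro: dvd_diff_nat)
    also have "(m - x * u) - (m - x * w) = x * d" using uw d by (auto simp: U_def distrib_left)
    finally have "lcm x y \<le> x * d" using pos d by (intro dvd_imp_le) auto
    then have "(x * u + lcm x y) div lcm x y \<le> x * w div lcm x y"
      using d by (intro div_le_mono) (simp add: distrib_left)
    then show "x * u div lcm x y \<noteq> x * w div lcm x y" using pos by (simp add: lcm_pos_nat)
  qed linarith
  moreover have "finite U" using inj U_div by (metis finite_atMost inj_on_finite)
  ultimately have "card (compositions m \<inter> line f) \<le> card {..m div lcm x y}"
    by (meson card_inj_on_le finite_atMost order_trans surj_card_le)
  then show ?thesis by (simp add: period_def x_def y_def)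
qed

lemma card_ray_le:
  assumes "0 < m"
  shows "card (compositions m \<inter> ray r) \<le> 1"
proof -
  have "sum_list (map ((*) t) r) = t * sum_list r" for t
    by (induction r) (simp_all add: distrib_left)
  then have "compositions m \<inter> ray r \<subseteq> {map ((*) (m div sum_list r)) r}"
    using assms by (auto simp: compositions_def ray_def)
  then have "card (compositions m \<inter> ray r) \<le> card {map ((*) (m div sum_list r)) r}"
    by (intro card_mono) simp_all
  then show ?thesis by simp
qed

definition lines :: "(nat \<Rightarrow> nat \<Rightarrow> nat list) list \<Rightarrow> nat list set"
  where "lines fs = (\<Union>f \<in> set fs. line f)"

definition rays :: "nat list list \<Rightarrow> nat list set"
  where "rays rs = (\<Union>r \<in> set rs. ray r)"

lemma card_lines_rays_le:
  assumes "list_all linear_sum fs" "0 < m"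
  shows "card (compositions m \<inter> (lines fs \<union> rays rs)) \<le>
    (\<Sum>p \<leftarrow> map period fs. m div p + 1) + length rs"
proof -
  have "card (compositions m \<inter> lines fs) \<le> (\<Sum>p \<leftarrow> map period fs. m div p + 1)"
    using assms(1)
  proof (induction fs)
    case (Cons f fs)
    have "compositions m \<inter> lines (f # fs) = (compositions m \<inter> line f) \<union> (compositions m \<inter> lines fs)"
      by (auto simp: lines_def)
    then have "card (compositions m \<inter> lines (f # fs)) \<le>
        card (compositions m \<inter> line f) + card (compositions m \<inter> lines fs)"
      by (simp only: card_Un_le)
    then show ?case using Cons card_line_le[of f m] by simp
  qed (simp add: lines_def)
  moreover have "card (compositions m \<inter> rays rs) \<le> length rs"
  proof (induction rs)
    case (Cons r rs)
    have "compositions m \<inter> rays (r # rs) = (compositions m \<inter> ray r) \<union> (compositions m \<inter> rays rs)"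
      by (auto simp: rays_def)
    then have "card (compositions m \<inter> rays (r # rs)) \<le>
        card (compositions m \<inter> ray r) + card (compositions m \<inter> rays rs)"
      by (simp only: card_Un_le)
    then show ?case using Cons card_ray_le[OF assms(2), of r] by simp
  qed (simp add: rays_def)
  ultimately show ?thesis
    using card_Un_le[of "compositions m \<inter> lines fs" "compositions m \<inter> rays rs"]
    by (simp add: Int_Un_distrib)
qed

section \<open>Compositions with few block sums\<close>

lemma equal_parts_if_block_sums_subset_prefix_sums:
  assumes "0 \<notin> set gs" "block_sums gs \<subseteq> prefix_sums gs"
  shows "gs \<in> ray (replicate (length gs) 1)"
  using assms
proof (induction gs)
  case (Cons a gs)
  let ?s = "sum_list (a # gs)"
  have "?s \<notin> block_sums gs" using block_sums_le_sum_list[of ?s gs] Cons.prems(1) by auto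
  then have sub: "block_sums gs \<subseteq> prefix_sums (a # gs) - {?s}" using Cons.prems(2) by auto
  have "card (prefix_sums (a # gs) - {?s}) = length gs"
    using sum_list_in_prefix_sums[of "a # gs"] card_prefix_sums[OF Cons.prems(1)] by simp
  then have "card (block_sums gs) \<le> card (prefix_sums gs)"
    using card_mono[OF _ sub] card_prefix_sums[of gs] Cons.prems(1) by simp
  then have "prefix_sums gs = block_sums gs"
    by (intro card_seteq prefix_sums_subset_block_sums) simp_all
  then obtain b where b: "gs = replicate (length gs) b"
    using Cons by (auto simp: ray_def map_replicate)
  have "a = b" if ne: "gs \<noteq> []"
  proof -
    obtain gs' where "gs = b # gs'" using b ne by (cases gs) auto
    then have "b = a \<or> (\<exists>s \<in> prefix_sums gs. b = a + s)" "\<forall>s \<in> prefix_sums gs. b \<le> s" "0 < a"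
      using sub Cons.prems(1) by auto
    then show ?thesis by fastforce
  qed
  then have "a # gs = map ((*) a) (replicate (length (a # gs)) 1)"
    using b by (cases gs) (auto simp: map_replicate)
  then show ?case unfolding ray_def by (rule range_eqI)
qed (simp add: ray_def)

text \<open>
  If a composition has seven block sums, then each of its block sums is a prefix sum or one of the
  few values left over. The following families are the cones of dimension two and one that solve
  the resulting linear systems; degenerate members have fewer than seven block sums.
\<close>

definition lines_7 :: "(nat \<Rightarrow> nat \<Rightarrow> nat list) list" where
  "lines_7 = [\<lambda>u v. [u, u, u, v], \<lambda>u v. [u, v, v, v], \<lambda>u v. [u, v, u + v, v],
    \<lambda>u v. [u, u + v, u, v], \<lambda>u v. [2 * u + v, u, v, u], \<lambda>u v. [u, v, u, 2 * u + v],
    \<lambda>u v. [u, u + v, v, u], \<lambda>u v. [u, v, u + v, u], \<lambda>u v. [u + v, u, v, u + v],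
    \<lambda>u v. [u + v, u + v, u, v], \<lambda>u v. [u, v, u + v, u + v], \<lambda>u v. [2 * u, v, u, u],
    \<lambda>u v. [u, u, v, 2 * u], \<lambda>u v. [u + 2 * v, u, v, u + v], \<lambda>u v. [u + v, v, u, u + 2 * v],
    \<lambda>u v. [u + v, u, u, v], \<lambda>u v. [u, v, v, u + v], \<lambda>u v. [u, u, v, u, u],
    \<lambda>u v. [u, v, u, v, u], \<lambda>u v. [u + v, u, v, u, u + v]]"

definition rays_7 :: "nat list list" where
  "rays_7 = [[1, 1, 2, 3], [3, 2, 1, 1], [1, 1, 2, 4], [2, 1, 1, 4], [2, 2, 1, 3], [3, 1, 2, 2],
    [4, 1, 1, 2], [4, 2, 1, 1], [1, 1, 1, 1, 2], [1, 1, 1, 2, 1], [1, 2, 1, 1, 1], [2, 1, 1, 1, 1],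
    [1, 1, 1, 1, 3], [1, 1, 1, 2, 2], [1, 1, 1, 3, 1], [1, 1, 2, 1, 2], [1, 1, 2, 2, 1],
    [1, 2, 1, 1, 2], [1, 2, 2, 1, 1], [1, 3, 1, 1, 1], [2, 1, 1, 2, 1], [2, 1, 2, 1, 1],
    [2, 2, 1, 1, 1], [3, 1, 1, 1, 1], [1, 2, 1, 1, 3], [2, 1, 1, 1, 3], [2, 1, 1, 2, 2],
    [2, 2, 1, 1, 2], [3, 1, 1, 1, 2], [3, 1, 1, 2, 1], [3, 1, 1, 1, 3], [1, 1, 1, 1, 1, 1],
    [1, 1, 1, 1, 1, 2], [1, 1, 1, 1, 2, 1], [1, 1, 1, 2, 1, 1], [1, 1, 2, 1, 1, 1],
    [1, 2, 1, 1, 1, 1], [2, 1, 1, 1, 1, 1], [2, 1, 1, 1, 1, 2], [1, 1, 1, 1, 1, 1, 1]]"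

(* z3 solves the linear problems below over the integers, but not over the natural numbers. *)
lemmas nat_to_int = int_int_eq [symmetric] of_nat_0_less_iff [where ?'a = int, symmetric] int_ops

lemmas family_simps = lines_def line_def rays_def ray_def image_iff

lemma three_gaps_four_sums:
  assumes "0 \<notin> set [a, b, c]" "block_sums [a, b, c] - prefix_sums [a, b, c] = {x}"
  shows "[a, b, c] \<in> lines [\<lambda>u v. [u, v, u]] \<union> rays [[1, 1, 2], [2, 1, 1], [1, 1, 1, 1]]"
proof -
  have "block_sums [a, b, c] \<subseteq> prefix_sums [a, b, c] \<union> {x}" using assms(2) by blast
  then show ?thesis
    using assms(1) by (auto simp: family_simps)
qed

lemma four_gaps_seven_sums:
  assumes "0 \<notin> set [a, b, c, d]" "block_sums [a, b, c, d] - prefix_sums [a, b, c, d] = {x, y, z}"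
    "distinct [x, y, z]"
  shows "[a, b, c, d] \<in> lines lines_7 \<union> rays rays_7"
proof -
  have "block_sums [a, b, c, d] \<subseteq> prefix_sums [a, b, c, d] \<union> {x, y, z}"
    "{x, y, z} \<subseteq> block_sums [a, b, c, d] - prefix_sums [a, b, c, d]"
    using assms(2) by blast+
  then show ?thesis
    using assms(1,3)
    by (simp add: family_simps lines_7_def rays_7_def, simp only: nat_to_int, smt (z3))
qed

lemma five_gaps_seven_sums:
  assumes "0 \<notin> set [a, b, c, d, e]"
    "block_sums [a, b, c, d, e] - prefix_sums [a, b, c, d, e] = {x, y}"
  shows "[a, b, c, d, e] \<in> lines lines_7 \<union> rays rays_7"
proof -
  have "block_sums [a, b, c, d, e] \<subseteq> {x, y} \<union> prefix_sums [a, b, c, d, e]"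
    using assms(2) by blast
  then show ?thesis
    using assms(1)
    by (simp add: family_simps lines_7_def rays_7_def, simp only: nat_to_int, smt (z3))
qed

lemma six_gaps_seven_sums:
  assumes "0 \<notin> set [a, b, c, d, e, f]"
    "block_sums [a, b, c, d, e, f] - prefix_sums [a, b, c, d, e, f] = {x}"
  shows "[a, b, c, d, e, f] \<in> lines lines_7 \<union> rays rays_7"
proof -
  have "block_sums [a, b, c, d, e, f] \<subseteq> {x} \<union> prefix_sums [a, b, c, d, e, f]"
    using assms(2) by blast
  then show ?thesis
    using assms(1)
    by (simp add: family_simps lines_7_def rays_7_def, simp only: nat_to_int, smt (z3))
qed

lemma block_class_cases:
  assumes "gs \<in> block_class k m"
  obtains zs where "0 \<notin> set gs" "set zs = block_sums gs - prefix_sums gs" "distinct zs"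
    "length gs + length zs = k" "2 * k \<le> length gs * (length gs + 1)"
proof -
  have gs: "0 \<notin> set gs" "card (block_sums gs) = k"
    using assms by (auto simp: block_class_def compositions_def)
  obtain zs where "set zs = block_sums gs - prefix_sums gs" "distinct zs"
    "length zs = k - length gs"
    using block_sums_minus_prefix_sums[OF gs(1)] gs(2) by metis
  then show thesis
    using that[of zs] gs length_le_card_block_sums[of gs] card_block_sums_le[of gs] by simp
qed

lemma block_class_2_subset: "block_class 2 m \<subseteq> lines [] \<union> rays [[1, 1]]"
proof
  fix gs assume "gs \<in> block_class 2 m"
  then obtain zs where gs: "0 \<notin> set gs" "set zs = block_sums gs - prefix_sums gs"
    "length gs + length zs = 2" "2 * 2 \<le> length gs * (length gs + 1)"
    by (rule block_class_cases)
  then have "\<not> length gs \<le> 1" using mult_le_mono[of "length gs" 1 "length gs + 1" 2] by auto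
  then have "length gs = 2" "length zs = 0" using gs(3) by linarith+
  then have "gs \<in> ray (replicate 2 1)"
    using equal_parts_if_block_sums_subset_prefix_sums[OF gs(1)] gs(2) by auto
  then show "gs \<in> lines [] \<union> rays [[1, 1]]" by (simp add: rays_def numeral_eq_Suc)
qed

lemma block_class_4_subset:
  "block_class 4 m \<subseteq> lines [\<lambda>u v. [u, v, u]] \<union> rays [[1, 1, 2], [2, 1, 1], [1, 1, 1, 1]]"
proof
  fix gs assume "gs \<in> block_class 4 m"
  then obtain zs where gs: "0 \<notin> set gs" "set zs = block_sums gs - prefix_sums gs"
    "length gs + length zs = 4" "2 * 4 \<le> length gs * (length gs + 1)"
    by (rule block_class_cases)
  then have "\<not> length gs \<le> 2" using mult_le_mono[of "length gs" 2 "length gs + 1" 3] by auto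
  then consider "length gs = 3" "length zs = 1" | "length gs = 4" "length zs = 0"
    using gs(3) by linarith
  then show "gs \<in> lines [\<lambda>u v. [u, v, u]] \<union> rays [[1, 1, 2], [2, 1, 1], [1, 1, 1, 1]]"
  proof cases
    case 1
    then obtain a b c x where "gs = [a, b, c]" "zs = [x]"
      by (auto simp: numeral_eq_Suc length_Suc_conv)
    then show ?thesis using three_gaps_four_sums[of a b c x] gs(1,2) by simp
  next
    case 2
    then have "gs \<in> ray (replicate 4 1)"
      using equal_parts_if_block_sums_subset_prefix_sums[OF gs(1)] gs(2) by auto
    then show ?thesis by (simp add: rays_def numeral_eq_Suc)
  qed
qed

lemma block_class_7_subset: "block_class 7 m \<subseteq> lines lines_7 \<union> rays rays_7"
proof
  fix gs assume "gs \<in> block_class 7 m"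
  then obtain zs where gs: "0 \<notin> set gs" "set zs = block_sums gs - prefix_sums gs" "distinct zs"
    "length gs + length zs = 7" "2 * 7 \<le> length gs * (length gs + 1)"
    by (rule block_class_cases)
  then have "\<not> length gs \<le> 3" using mult_le_mono[of "length gs" 3 "length gs + 1" 4] by auto
  then consider "length gs = 4" "length zs = 3" | "length gs = 5" "length zs = 2"
    | "length gs = 6" "length zs = 1" | "length gs = 7" "length zs = 0"
    using gs(4) by linarith
  then show "gs \<in> lines lines_7 \<union> rays rays_7"
  proof cases
    case 1
    then obtain a b c d x y z where "gs = [a, b, c, d]" "zs = [x, y, z]"
      by (auto simp: numeral_eq_Suc length_Suc_conv)
    then show ?thesis using gs(1-3) by (metis four_gaps_seven_sums list.set)
  next
    case 2
    then obtain a b c d e x y where "gs = [a, b, c, d, e]" "zs = [x, y]"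
      by (auto simp: numeral_eq_Suc length_Suc_conv)
    then show ?thesis using gs(1,2) by (metis five_gaps_seven_sums list.set)
  next
    case 3
    then obtain a b c d e f x where "gs = [a, b, c, d, e, f]" "zs = [x]"
      by (auto simp: numeral_eq_Suc length_Suc_conv)
    then show ?thesis using gs(1,2) by (metis six_gaps_seven_sums list.set)
  next
    case 4
    then have "gs \<in> ray (replicate 7 1)"
      using equal_parts_if_block_sums_subset_prefix_sums[OF gs(1)] gs(2) by auto
    then show ?thesis by (simp add: rays_def rays_7_def numeral_eq_Suc)
  qed
qed

lemma card_block_class_le:
  assumes "block_class k m \<subseteq> lines fs \<union> rays rs" "list_all linear_sum fs" "0 < m"
  shows "card (block_class k m) \<le> (\<Sum>p \<leftarrow> map period fs. m div p + 1) + length rs"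
proof -
  have "block_class k m \<subseteq> compositions m \<inter> (lines fs \<union> rays rs)"
    using assms(1) by (auto simp: block_class_def)
  then have "card (block_class k m) \<le> card (compositions m \<inter> (lines fs \<union> rays rs))"
    by (intro card_mono) simp_all
  then show ?thesis using card_lines_rays_le[OF assms(2,3)] by (rule order_trans)
qed

lemma card_block_class_2_le:
  assumes "0 < m"
  shows "card (block_class 2 m) \<le> 1"
  using card_block_class_le[OF block_class_2_subset _ assms] by simp

lemma card_block_class_4_le:
  assumes "0 < m"
  shows "card (block_class 4 m) \<le> m div 2 + 4"
proof -
  have "map period [\<lambda>u v. [u, v, u]] = [2]" by code_simp
  then show ?thesis
    using card_block_class_le[OF block_class_4_subset _ assms] by (simp add: linear_sum_def)
qed

lemma card_block_class_7_le:
  assumes "0 < m"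
  shows "12 * card (block_class 7 m) \<le> 52 * m + 720"
proof -
  have "list_all linear_sum lines_7"
    by (simp add: lines_7_def linear_sum_def distrib_left)
  then have "card (block_class 7 m) \<le> (\<Sum>p \<leftarrow> map period lines_7. m div p + 1) + length rays_7"
    by (rule card_block_class_le[OF block_class_7_subset _ assms])
  also have "map period lines_7 =
      [3, 3, 6, 6, 4, 4, 6, 6, 3, 3, 3, 4, 4, 12, 12, 6, 6, 4, 6, 12]"
    by code_simp
  also have "(\<Sum>p \<leftarrow> [3, 3, 6, 6, 4, 4, 6, 6, 3, 3, 3, 4, 4, 12, 12, 6, 6, 4, 6, 12]. m div p + 1) =
      5 * (m div 3) + 5 * (m div 4) + 7 * (m div 6) + 3 * (m div 12) + 20"
    by simp
  also have "length rays_7 = 40" by (simp add: rays_7_def)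
  finally show ?thesis by linarith
qed

section \<open>Generic compositions\<close>

lemma card_le_block_class:
  assumes "A \<subseteq> compositions m" "A \<subseteq> block_class k m \<union> (lines fs \<union> rays rs)"
    and "list_all linear_sum fs" "0 < m"
  shows "card A \<le> card (block_class k m) + (\<Sum>p \<leftarrow> map period fs. m div p + 1) + length rs"
proof -
  have "A \<subseteq> block_class k m \<union> compositions m \<inter> (lines fs \<union> rays rs)" using assms(1,2) by blast
  then have "card A \<le> card (block_class k m \<union> compositions m \<inter> (lines fs \<union> rays rs))"
    by (intro card_mono) simp_all
  also have "\<dots> \<le> card (block_class k m) + card (compositions m \<inter> (lines fs \<union> rays rs))"
    by (rule card_Un_le)
  finally show ?thesis using card_lines_rays_le[OF assms(3,4), of rs] by linarith
qed

lemma card_block_class_1_ge: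
  assumes "0 < m"
  shows "1 \<le> card (block_class 1 m)"
proof -
  have "[m] \<in> block_class 1 m" using assms by (simp add: block_class_def compositions_def)
  then have "0 < card (block_class 1 m)" by (auto simp: card_gt_0_iff)
  then show ?thesis by simp
qed

lemma card_block_class_3_ge:
  assumes "2 \<le> m"
  shows "m \<le> card (block_class 3 m) + 2"
proof -
  let ?A = "{gs \<in> compositions m. length gs = 2}"
  have "?A \<subseteq> block_class 3 m \<union> (lines [] \<union> rays [[1, 1]])"
  proof
    fix gs assume gs: "gs \<in> ?A"
    then obtain a b where ab: "gs = [a, b]" "0 < a" "0 < b"
      by (auto simp: compositions_def numeral_eq_Suc length_Suc_conv)
    show "gs \<in> block_class 3 m \<union> (lines [] \<union> rays [[1, 1]])"
    proof (cases "a = b")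
      case False
      then have "card (block_sums gs) = 3" using ab by simp
      then show ?thesis using gs by (simp add: block_class_def)
    qed (auto simp: ab rays_def ray_def)
  qed
  then have "card ?A \<le> card (block_class 3 m) + 1"
    using card_le_block_class[of ?A m 3 "[]" "[[1, 1]]"] assms by auto
  moreover have "card ?A = m - 1" using card_compositions_length[of 2 m] assms by simp
  ultimately show ?thesis by linarith
qed

lemma card_block_class_5_ge:
  assumes "0 < m"
  shows "m \<le> card (block_class 5 m) + 6"
proof -
  let ?R = "[[1, 1, 1], [1, 1, 2], [2, 1, 1]]"
  define h where "h = (m - 1) div 2"
  define A where "A = (\<lambda>u. [u, u, m - 2 * u]) ` {1..h}"
  define B where "B = (\<lambda>u. [m - 2 * u, u, u]) ` {1..h}"
  have AB: "A \<union> B \<subseteq> compositions m" by (auto simp: A_def B_def h_def compositions_def)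
  have "A \<union> B \<subseteq> block_class 5 m \<union> (lines [] \<union> rays ?R)"
  proof
    fix gs assume gs: "gs \<in> A \<union> B"
    then obtain u where u: "1 \<le> u" "u \<le> h" "gs = [u, u, m - 2 * u] \<or> gs = [m - 2 * u, u, u]"
      by (auto simp: A_def B_def)
    define v where "v = m - 2 * u"
    have uv: "0 < u" "0 < v" "gs = [u, u, v] \<or> gs = [v, u, u]"
      using u assms by (auto simp: v_def h_def)
    show "gs \<in> block_class 5 m \<union> (lines [] \<union> rays ?R)"
    proof (cases "v = u \<or> v = 2 * u")
      case False
      then have "card (block_sums gs) = 5" using uv by (auto simp: card_insert_if)
      then show ?thesis using gs AB by (auto simp: block_class_def)
    qed (use uv in \<open>auto simp: rays_def ray_def image_iff\<close>)
  qed
  then have "card (A \<union> B) \<le> card (block_class 5 m) + 3"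
    using card_le_block_class[OF AB, of 5 "[]" ?R] assms by simp
  moreover have "card A = h" "card B = h"
    unfolding A_def B_def by (simp_all add: card_image inj_on_def)
  moreover have "card (A \<inter> B) \<le> card {[m div 3, m div 3, m div 3]}"
    by (intro card_mono) (auto simp: A_def B_def)
  then have "card (A \<inter> B) \<le> 1" by simp
  moreover have "card A + card B = card (A \<union> B) + card (A \<inter> B)"
    by (rule card_Un_Int) (simp_all add: A_def B_def)
  ultimately show ?thesis unfolding h_def by linarith
qed

lemma card_block_class_6_ge:
  assumes "3 \<le> m"
  shows "(m - 1) * (m - 2) \<le> 2 * card (block_class 6 m) + 5 * m + 10"
proof -
  let ?A = "{gs \<in> compositions m. length gs = 3}"
  let ?L = "[\<lambda>u v. [u, u, v], \<lambda>u v. [u, v, u], \<lambda>u v. [v, u, u], \<lambda>u v. [u + v, u, v],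
    \<lambda>u v. [u, v, u + v]]"
  have "?A \<subseteq> block_class 6 m \<union> (lines ?L \<union> rays [])"
  proof
    fix gs assume gs: "gs \<in> ?A"
    then obtain a b c where abc: "gs = [a, b, c]" "0 < a" "0 < b" "0 < c"
      by (auto simp: compositions_def numeral_eq_Suc length_Suc_conv)
    show "gs \<in> block_class 6 m \<union> (lines ?L \<union> rays [])"
    proof (cases "a = b \<or> a = c \<or> b = c \<or> a = b + c \<or> c = a + b")
      case True
      then show ?thesis using abc by (auto simp: lines_def line_def)
    next
      case False
      then have "card (block_sums gs) = 6" using abc by (simp add: card_insert_if)
      then show ?thesis using gs by (simp add: block_class_def)
    qed
  qed
  moreover have "list_all linear_sum ?L" by (simp add: linear_sum_def)
  moreover have "map period ?L = [2, 2, 2, 2, 2]" by code_simp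
  ultimately have "card ?A \<le> card (block_class 6 m) + 5 * (m div 2) + 5"
    using card_le_block_class[of ?A m 6 ?L "[]"] assms by simp
  moreover have "2 * card ?A = (m - 1) * (m - 2)"
    using card_compositions_length[of 3 m] assms by (simp add: choose_two)
  ultimately show ?thesis by linarith
qed

definition plane :: "(nat \<Rightarrow> nat \<Rightarrow> nat \<Rightarrow> nat list) \<Rightarrow> nat list set"
  where "plane f = {f u v w | u v w. 0 < u \<and> 0 < v \<and> 0 < w}"

definition lines_8 :: "(nat \<Rightarrow> nat \<Rightarrow> nat list) list" where
  "lines_8 = [\<lambda>u v. [u, u, v, u], \<lambda>u v. [u, v, u, u], \<lambda>u v. [u, v, v, u],
    \<lambda>u v. [u + v, u, v, u + v], \<lambda>u v. [u, u + v, v, u], \<lambda>u v. [u, v, u + v, u],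
    \<lambda>u v. [u, u, v, 2 * u], \<lambda>u v. [u, v, u, u + v], \<lambda>u v. [u, v, v, u + v],
    \<lambda>u v. [u, v, u + v, u + v], \<lambda>u v. [u + v, u, v, 2 * u + v],
    \<lambda>u v. [2 * u, v, u, u], \<lambda>u v. [u + v, u, v, u], \<lambda>u v. [u + v, v, v, u],
    \<lambda>u v. [u + v, u + v, v, u], \<lambda>u v. [2 * u + v, v, u, u + v]]"

definition planes_8 :: "nat list set" where
  "planes_8 = plane (\<lambda>u v w. [u, v, w, u]) \<union> plane (\<lambda>u v w. [u, v, w, u + v])
    \<union> plane (\<lambda>u v w. [u + v, w, v, u])"

lemma planes_8_subset: "compositions m \<inter> planes_8 \<subseteq> block_class 8 m \<union> lines lines_8"
proof
  fix gs assume gs: "gs \<in> compositions m \<inter> planes_8"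
  then obtain u v w where pos: "0 < u" "0 < v" "0 < w"
    and shape: "gs = [u, v, w, u] \<or> gs = [u, v, w, u + v] \<or> gs = [u + v, w, v, u]"
    unfolding planes_8_def plane_def by blast
  show "gs \<in> block_class 8 m \<union> lines lines_8"
  proof (cases "u = v \<or> u = w \<or> v = w \<or> u = v + w \<or> w = u + v \<or> v = u + w \<and> gs = [u, v, w, u]")
    case True
    then have "gs \<in> lines lines_8" using pos shape by (auto simp: lines_8_def lines_def line_def)
    then show ?thesis by blast
  next
    case False
    then consider "v \<noteq> u + w" "gs = [u, v, w, u]" | "gs = [u, v, w, u + v]"
      | "gs = [u + v, w, v, u]"
      using shape by blast
    then have "card (block_sums gs) = 8"
      using pos False by cases (simp_all add: card_insert_if)
    then show ?thesis using gs by (simp add: block_class_def)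
  qed
qed

lemma card_planes_8_ge:
  assumes "2 * h < m"
  shows "2 * (h * (h - 1)) \<le> card (compositions m \<inter> planes_8)"
proof -
  define T where "T c = (SIGMA u : {1..h}. {1..c * (h - u)})" for c
  define A where "A = (\<lambda>(u, v). [u, v, m - 2 * u - v, u]) ` T 2"
  define B where "B = (\<lambda>(u, v). [u, v, m - 2 * u - 2 * v, u + v]) ` T 1"
  define C where "C = (\<lambda>(u, v). [u + v, m - 2 * u - 2 * v, v, u]) ` T 1"
  have "(\<Sum>u = 1..h. h - u) = \<Sum>{0..<h}"
    by (rule sum.reindex_bij_witness[of _ "\<lambda>j. h - j" "\<lambda>u. h - u"]) auto
  moreover have "even (h * (h - 1))" by auto
  ultimately have "2 * (\<Sum>u = 1..h. h - u) = h * (h - 1)" by (simp add: Sum_Ico_nat)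
  then have T: "2 * card (T c) = c * (h * (h - 1))" for c
    by (simp add: T_def flip: sum_distrib_left)
  have "card A = card (T 2)" "card B = card (T 1)" "card C = card (T 1)"
    unfolding A_def B_def C_def by (intro card_image; auto simp: inj_on_def)+
  moreover have "A \<inter> B = {}" "(A \<union> B) \<inter> C = {}"
    by (auto simp: A_def B_def C_def T_def)
  moreover have "finite A" "finite B" "finite C"
    by (simp_all add: A_def B_def C_def T_def)
  ultimately have "card (A \<union> B \<union> C) = 2 * (h * (h - 1))"
    using T[of 1] T[of 2] by (simp add: card_Un_disjoint)
  moreover have "A \<union> B \<union> C \<subseteq> compositions m"
    using assms by (auto simp: A_def B_def C_def T_def compositions_def)
  moreover have "A \<subseteq> plane (\<lambda>u v w. [u, v, w, u])"
    "B \<subseteq> plane (\<lambda>u v w. [u, v, w, u + v])" "C \<subseteq> plane (\<lambda>u v w. [u + v, w, v, u])"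
    using assms by (auto simp: A_def B_def C_def T_def plane_def)
  ultimately show ?thesis
    using card_mono[of "compositions m \<inter> planes_8" "A \<union> B \<union> C"] by (auto simp: planes_8_def)
qed

lemma card_block_class_8_ge:
  assumes "4 \<le> m"
  shows "6 * ((m - 2) * (m - 4)) \<le> 12 * card (block_class 8 m) + 46 * m + 192"
proof -
  define h where "h = (m - 1) div 2"
  have "map period lines_8 = [3, 3, 2, 3, 6, 6, 4, 6, 6, 3, 12, 4, 6, 6, 3, 12]" by code_simp
  then have "(\<Sum>p \<leftarrow> map period lines_8. m div p + 1) =
      m div 2 + 5 * (m div 3) + 2 * (m div 4) + 6 * (m div 6) + 2 * (m div 12) + 16"
    by simp
  moreover have "list_all linear_sum lines_8"
    by (simp add: lines_8_def linear_sum_def distrib_left)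
  ultimately have "card (compositions m \<inter> planes_8) \<le> card (block_class 8 m) +
      (m div 2 + 5 * (m div 3) + 2 * (m div 4) + 6 * (m div 6) + 2 * (m div 12) + 16)"
    using card_le_block_class[of "compositions m \<inter> planes_8" m 8 lines_8 "[]"] planes_8_subset assms
    by (simp add: rays_def)
  moreover have "2 * (h * (h - 1)) \<le> card (compositions m \<inter> planes_8)"
    using assms by (intro card_planes_8_ge) (auto simp: h_def)
  moreover have "(m - 2) * (m - 4) \<le> (2 * h) * (2 * (h - 1))"
    using assms by (intro mult_le_mono) (auto simp: h_def)
  then have "(m - 2) * (m - 4) \<le> 2 * (2 * (h * (h - 1)))" by simp
  ultimately show ?thesis by linarith
qed

section \<open>Counting compositions by search\<close>

fun refinements :: "nat \<Rightarrow> nat \<Rightarrow> nat list \<Rightarrow> nat list list" where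
  "refinements 0 a gs = [a # gs]"
| "refinements (Suc n) a gs = refinements n (Suc a) gs @ refinements n 1 (a # gs)"

lemma set_refinements:
  assumes "0 < a"
  shows "set (refinements n a gs) =
    {ks @ b # gs | ks b. a \<le> b \<and> 0 \<notin> set ks \<and> sum_list ks + b = n + a}"
  using assms
proof (induction n arbitrary: a gs)
  case 0
  have "ks = []" if "0 \<notin> set ks" "sum_list ks = 0" for ks :: "nat list"
    using that by (cases ks) auto
  then show ?case by fastforce
next
  case (Suc n)
  have "hs \<in> set (refinements (Suc n) a gs)"
    if hs: "hs = ks @ b # gs" "a \<le> b" "0 \<notin> set ks" "sum_list ks + b = Suc n + a" for hs ks b
  proof (cases "a < b")
    case True
    then show ?thesis using Suc hs by fastforce
  next
    case False
    then have "ks \<noteq> []" using hs by auto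
    then obtain ks' c where "ks = ks' @ [c]" by (cases ks rule: rev_exhaust) auto
    then show ?thesis using Suc False hs by fastforce
  qed
  moreover have "\<exists>ks b. hs = ks @ b # gs \<and> a \<le> b \<and> 0 \<notin> set ks \<and> sum_list ks + b = Suc n + a"
    if hs: "hs \<in> set (refinements (Suc n) a gs)" for hs
  proof -
    consider "hs \<in> set (refinements n (Suc a) gs)" | "hs \<in> set (refinements n 1 (a # gs))"
      using hs by auto
    then show ?thesis
    proof cases
      case 1
      then show ?thesis using Suc.IH[of "Suc a" gs] by fastforce
    next
      case 2
      then obtain ks b where "hs = ks @ b # a # gs" "1 \<le> b" "0 \<notin> set ks" "sum_list ks + b = n + 1"
        using Suc.IH[of 1 "a # gs"] by auto
      then show ?thesis by (intro exI[of _ "ks @ [b]"] exI[of _ a]) simp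
    qed
  qed
  ultimately show ?case by blast
qed

lemma distinct_refinements: "0 < a \<Longrightarrow> distinct (refinements n a gs)"
proof (induction n arbitrary: a gs)
  case (Suc n)
  have "ks @ b # gs \<noteq> ks' @ b' # a # gs" if "a < b" for ks b ks' b'
  proof
    assume "ks @ b # gs = ks' @ b' # a # gs"
    then have "(ks @ [b]) @ gs = ((ks' @ [b']) @ [a]) @ gs" by simp
    then show False using that unfolding append_same_eq by simp
  qed
  then show ?case using Suc by (auto simp: set_refinements)
qed simp

lemma compositions_eq_refinements:
  assumes "0 < m"
  shows "compositions m = set (refinements (m - 1) 1 [])"
proof (intro equalityI subsetI)
  fix gs assume gs: "gs \<in> compositions m"
  then have "gs \<noteq> []" using assms by (auto simp: compositions_def)
  then obtain ks b where "gs = ks @ [b]" by (cases gs rule: rev_exhaust) auto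
  then show "gs \<in> set (refinements (m - 1) 1 [])"
    using gs by (auto simp: set_refinements compositions_def)
qed (use assms in \<open>auto simp: set_refinements compositions_def\<close>)

lemma block_sums_refinements:
  "hs \<in> set (refinements n a gs) \<Longrightarrow> block_sums ((n + a) # gs) \<subseteq> block_sums hs"
proof (induction n arbitrary: a gs)
  case (Suc n)
  consider "hs \<in> set (refinements n (Suc a) gs)" | "hs \<in> set (refinements n 1 (a # gs))"
    using Suc.prems by auto
  then show ?case
  proof cases
    case 1
    then show ?thesis using Suc.IH by fastforce
  next
    case 2
    have "block_sums ((Suc n + a) # gs) \<subseteq> block_sums ((n + 1) # a # gs)"
      by (auto simp: image_image add.assoc)
    then show ?thesis using Suc.IH[OF 2] by (rule subset_trans)
  qed
qed simp

lemma filter_refinements_eq_Nil: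
  assumes "j < card (block_sums ((n + a) # gs))"
  shows "filter (\<lambda>hs. card (block_sums hs) = j) (refinements n a gs) = []"
proof -
  have "j < card (block_sums hs)" if "hs \<in> set (refinements n a gs)" for hs
    using assms card_mono[OF finite_block_sums block_sums_refinements[OF that]] by linarith
  then show ?thesis by (auto simp: filter_empty_conv)
qed

fun bit_set :: "bool list \<Rightarrow> nat set" where
  "bit_set [] = {}"
| "bit_set (b # bs) = (if b then {1} else {}) \<union> Suc ` bit_set bs"

fun bit_union :: "bool list \<Rightarrow> bool list \<Rightarrow> bool list" where
  "bit_union [] ys = ys"
| "bit_union xs [] = xs"
| "bit_union (x # xs) (y # ys) = (x \<or> y) # bit_union xs ys"

fun bit_count :: "bool list \<Rightarrow> nat" where
  "bit_count [] = 0"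
| "bit_count (b # bs) = of_bool b + bit_count bs"

fun add_counts :: "nat list \<Rightarrow> nat list \<Rightarrow> nat list" where
  "add_counts [] ys = ys"
| "add_counts xs [] = xs"
| "add_counts (x # xs) (y # ys) = (x + y) # add_counts xs ys"

text \<open>
  The argument \<open>P\<close> encodes \<^term>\<open>prefix_sums (a # gs)\<close> and \<open>D\<close> encodes
  \<^term>\<open>block_sums ((n + a) # gs)\<close>. Entry \<open>j\<close> of the result counts the refinements with \<open>j\<close> block
  sums; since refining only adds block sums, branches with more than \<open>k\<close> of them are pruned.
\<close>

fun tally :: "nat \<Rightarrow> nat \<Rightarrow> bool list \<Rightarrow> bool list \<Rightarrow> nat list" where
  "tally k 0 P D = replicate (bit_count D) 0 @ [1]"
| "tally k (Suc n) P D = add_counts (tally k n (False # P) D)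
    (let D' = bit_union D (bit_union P (replicate n False @ [True])) in
      if bit_count D' \<le> k then tally k n (True # P) D' else [])"

definition block_class_counts :: "nat \<Rightarrow> nat list"
  where "block_class_counts m = tally 8 (m - 1) [True] (replicate (m - 1) False @ [True])"

lemma bit_set_bit_union: "bit_set (bit_union xs ys) = bit_set xs \<union> bit_set ys"
  by (induction xs ys rule: bit_union.induct) auto

lemma bit_set_single: "bit_set (replicate n False @ [True]) = {Suc n}"
  by (induction n) auto

lemma bit_count_eq_card: "bit_count bs = card (bit_set bs)"
proof (induction bs)
  case (Cons b bs)
  have "finite (bit_set bs)" "0 \<notin> bit_set bs" by (induction bs) auto
  moreover from this have "1 \<notin> Suc ` bit_set bs" by auto
  ultimately show ?case using Cons by (simp add: card_image)
qed simp

lemma nth_default_add_counts: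
  "nth_default 0 (add_counts xs ys) j = nth_default 0 xs j + nth_default 0 ys j"
  by (induction xs ys arbitrary: j rule: add_counts.induct)
    (auto simp: nth_default_Cons split: nat.split)

lemma nth_default_tally:
  assumes "bit_set P = prefix_sums (a # gs)" "bit_set D = block_sums ((n + a) # gs)" "j \<le> k"
  shows "nth_default 0 (tally k n P D) j =
    length (filter (\<lambda>hs. card (block_sums hs) = j) (refinements n a gs))"
  using assms(1,2)
proof (induction n arbitrary: a gs P D)
  case 0
  then show ?case
    by (simp add: bit_count_eq_card nth_default_append nth_default_Cons split: nat.split)
next
  case (Suc n)
  let ?count = "\<lambda>n a gs. length (filter (\<lambda>hs. card (block_sums hs) = j) (refinements n a gs))"
  define D' where "D' = bit_union D (bit_union P (replicate n False @ [True]))"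
  have P: "bit_set (False # P) = prefix_sums (Suc a # gs)"
    "bit_set (True # P) = prefix_sums (1 # a # gs)"
    using Suc.prems(1) by (auto simp: image_image)
  have D': "bit_set D' = block_sums ((n + 1) # a # gs)"
    unfolding D'_def bit_set_bit_union bit_set_single Suc.prems
    by (auto simp: image_image add.assoc)
  have uncut: "nth_default 0 (tally k n (False # P) D) j = ?count n (Suc a) gs"
    using P(1) Suc.prems(2) by (intro Suc.IH) simp_all
  have cut: "nth_default 0 (if bit_count D' \<le> k then tally k n (True # P) D' else []) j =
      ?count n 1 (a # gs)"
  proof (cases "bit_count D' \<le> k")
    case True
    then show ?thesis using P(2) D' by (simp add: Suc.IH)
  next
    case False
    then have "j < card (block_sums ((n + 1) # a # gs))"
      using D' assms(3) by (simp add: bit_count_eq_card)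
    from filter_refinements_eq_Nil[OF this] show ?thesis using False by simp
  qed
  have "tally k (Suc n) P D = add_counts (tally k n (False # P) D)
      (if bit_count D' \<le> k then tally k n (True # P) D' else [])"
    unfolding D'_def by (simp only: tally.simps Let_def)
  then show ?case
    by (simp only: nth_default_add_counts uncut cut refinements.simps filter_append length_append)
qed

lemma card_block_class_eq:
  assumes "0 < m" "j \<le> 8"
  shows "card (block_class j m) = nth_default 0 (block_class_counts m) j"
proof -
  let ?rs = "refinements (m - 1) 1 []"
  have "nth_default 0 (block_class_counts m) j =
      length (filter (\<lambda>hs. card (block_sums hs) = j) ?rs)"
    unfolding block_class_counts_def using assms
    by (intro nth_default_tally) (simp_all add: bit_set_single)
  also have "\<dots> = card (set (filter (\<lambda>hs. card (block_sums hs) = j) ?rs))"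
    by (intro distinct_card[symmetric] distinct_filter distinct_refinements) simp
  also have "set (filter (\<lambda>hs. card (block_sums hs) = j) ?rs) = block_class j m"
    by (simp add: block_class_def compositions_eq_refinements[OF assms(1)])
  finally show ?thesis by simp
qed

section \<open>Comparison\<close>

definition valley_pairs :: "(nat \<times> nat) list"
  where "valley_pairs = [(2, 1), (2, 3), (4, 3), (4, 5), (7, 6), (7, 8)]"

definition has_valleys :: "nat list \<Rightarrow> bool"
  where "has_valleys cs \<longleftrightarrow>
    list_all (\<lambda>(l, k). nth_default 0 cs l \<le> nth_default 0 cs k) valley_pairs"

lemma has_valleys_block_class_counts: "list_all has_valleys (map block_class_counts [12..<28])"
  by code_simp

definition initial_counts :: "nat list list" where
  "initial_counts = [[0, 1], [0, 1, 1], [0, 1, 0, 3], [0, 1, 1, 2, 4], [0, 1, 0, 4, 2, 9],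
    [0, 1, 1, 5, 1, 7, 17], [0, 1, 0, 6, 3, 6, 15, 33], [0, 1, 1, 6, 6, 8, 16, 27, 63],
    [0, 1, 0, 9, 3, 6, 24, 24, 61], [0, 1, 1, 8, 4, 21, 28, 14, 66],
    [0, 1, 0, 10, 5, 10, 40, 29, 62]]"

lemma initial_counts_eq: "map block_class_counts [1..<12] = initial_counts"
  by code_simp

lemma sum_card_block_class_below_12:
  assumes "j \<le> 8"
  shows "(\<Sum>m = 1..<12. w m * card (block_class j m)) =
    (\<Sum>(m, cs) \<leftarrow> zip [1..<12] initial_counts. w m * nth_default 0 cs j)"
proof -
  have "(\<Sum>m = 1..<12. w m * card (block_class j m)) =
      (\<Sum>m \<leftarrow> [1..<12]. w m * nth_default 0 (block_class_counts m) j)"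
    unfolding interv_sum_list_conv_sum_set_nat set_upt
    using assms by (intro sum.cong) (simp_all add: card_block_class_eq)
  also have "\<dots> = (\<Sum>(m, cs) \<leftarrow> zip [1..<12] (map block_class_counts [1..<12]).
      w m * nth_default 0 cs j)"
    by (simp only: zip_map2 zip_same_conv_map map_map o_def prod.case id_apply)
  finally show ?thesis unfolding initial_counts_eq .
qed

lemma card_block_class_le_if_valley_pair:
  assumes "(l, k) \<in> set valley_pairs" "12 \<le> m"
  shows "card (block_class l m) \<le> card (block_class k m)"
proof (cases "m < 28")
  case True
  then have "block_class_counts m \<in> set (map block_class_counts [12..<28])"
    using assms(2) by (simp del: upt_rec_numeral)
  then have "has_valleys (block_class_counts m)"
    using has_valleys_block_class_counts unfolding list_all_iff by blast
  then have "nth_default 0 (block_class_counts m) l \<le> nth_default 0 (block_class_counts m) k"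
    using assms(1) by (auto simp: has_valleys_def list_all_iff)
  moreover have "l \<le> 8" "k \<le> 8" using assms(1) by (auto simp: valley_pairs_def)
  ultimately show ?thesis using assms(2) by (simp add: card_block_class_eq)
next
  case False
  then have m: "28 \<le> m" by simp
  have "27 * (m - 2) \<le> (m - 1) * (m - 2)" "26 * (m - 4) \<le> (m - 2) * (m - 4)"
    using m by (intro mult_le_mono1; simp)+
  then have "card (block_class 7 m) \<le> card (block_class 6 m)"
    "card (block_class 7 m) \<le> card (block_class 8 m)"
    using m card_block_class_6_ge[of m] card_block_class_7_le[of m] card_block_class_8_ge[of m]
    by linarith+
  moreover have "card (block_class 2 m) \<le> card (block_class 1 m)"
    "card (block_class 2 m) \<le> card (block_class 3 m)"
    "card (block_class 4 m) \<le> card (block_class 3 m)"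
    "card (block_class 4 m) \<le> card (block_class 5 m)"
    using m card_block_class_1_ge[of m] card_block_class_2_le[of m] card_block_class_3_ge[of m]
      card_block_class_4_le[of m] card_block_class_5_ge[of m] by linarith+
  ultimately show ?thesis using assms(1) by (auto simp: valley_pairs_def)
qed

lemma initial_sums_if_valley_pair:
  assumes "(l, k) \<in> set valley_pairs"
  shows "(\<Sum>m = 1..<12. card (block_class l m)) \<le> (\<Sum>m = 1..<12. card (block_class k m))"
    and "(\<Sum>m = 1..<12. (12 - m) * card (block_class l m)) <
      (\<Sum>m = 1..<12. (12 - m) * card (block_class k m))"
proof -
  let ?total = "\<lambda>w j. \<Sum>(m, cs) \<leftarrow> zip [1..<12] initial_counts. w m * nth_default 0 cs j"
  have bounds: "l \<le> 8" "k \<le> 8" using assms by (auto simp: valley_pairs_def)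
  have "list_all (\<lambda>(l, k). ?total (\<lambda>m. 1) l \<le> ?total (\<lambda>m. 1) k) valley_pairs"
    by code_simp
  then have "?total (\<lambda>m. 1) l \<le> ?total (\<lambda>m. 1) k" using assms by (auto simp only: list_all_iff)
  then show "(\<Sum>m = 1..<12. card (block_class l m)) \<le> (\<Sum>m = 1..<12. card (block_class k m))"
    unfolding bounds[THEN sum_card_block_class_below_12, symmetric] by simp
  have "list_all (\<lambda>(l, k). ?total (\<lambda>m. 12 - m) l < ?total (\<lambda>m. 12 - m) k) valley_pairs"
    by code_simp
  then have "?total (\<lambda>m. 12 - m) l < ?total (\<lambda>m. 12 - m) k"
    using assms by (auto simp only: list_all_iff)
  then show "(\<Sum>m = 1..<12. (12 - m) * card (block_class l m)) <
      (\<Sum>m = 1..<12. (12 - m) * card (block_class k m))"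
    unfolding bounds[THEN sum_card_block_class_below_12, symmetric] .
qed

lemma P_H_less_if_valley_pair:
  assumes "(l, k) \<in> set valley_pairs" "12 \<le> n"
  shows "P_H n (2 * l + 1) < P_H n (2 * k + 1)"
proof -
  have split: "(\<Sum>m = 1..<n. (n - m) * c m) =
      (\<Sum>m = 1..<12. (12 - m) * c m) + (n - 12) * (\<Sum>m = 1..<12. c m)
      + (\<Sum>m = 12..<n. (n - m) * c m)" for c :: "nat \<Rightarrow> nat"
  proof -
    have "(\<Sum>m = 1..<n. (n - m) * c m) =
        (\<Sum>m = 1..<12. (n - m) * c m) + (\<Sum>m = 12..<n. (n - m) * c m)"
      using assms(2) by (simp add: sum.atLeastLessThan_concat)
    also have "(\<Sum>m = 1..<12. (n - m) * c m) =
        (\<Sum>m = 1..<12. (12 - m) * c m + (n - 12) * c m)"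
      using assms(2) by (intro sum.cong) (auto simp flip: add_mult_distrib)
    finally show ?thesis by (simp only: sum.distrib sum_distrib_left)
  qed
  have "(\<Sum>m = 1..<n. (n - m) * card (block_class l m)) <
      (\<Sum>m = 1..<n. (n - m) * card (block_class k m))"
    unfolding split using assms
    by (intro add_less_le_mono mult_le_mono2 sum_mono initial_sums_if_valley_pair
        card_block_class_le_if_valley_pair) auto
  moreover have "0 < l" "0 < k" using assms(1) by (auto simp: valley_pairs_def)
  ultimately show ?thesis
    by (simp only: P_H_eq divide_strict_right_mono of_nat_less_iff zero_less_power
        zero_less_numeral)
qed

theorem theorem1p1:
  fixes n :: nat
  assumes "n \<ge> 12"
  shows "P_H n 3 > P_H n 5 \<and> P_H n 5 < P_H n 7 \<and>
         P_H n 7 > P_H n 9 \<and> P_H n 9 < P_H n 11 \<and>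
         P_H n 13 > P_H n 15 \<and> P_H n 15 < P_H n 17"
proof -
  have "\<forall>(l, k) \<in> set valley_pairs. P_H n (2 * l + 1) < P_H n (2 * k + 1)"
    using P_H_less_if_valley_pair assms by blast
  then show ?thesis by (simp add: valley_pairs_def)
qed

end
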